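(* Let $X$ and $Y$ be metric spaces such that the Gromov--Hausdorff distance between $X$ and $Y$ is finite. Then the semigroups $M(X)$ and $M(Y)$ are isomorphic.
   Context: For a metric space $(X,d_X)$, write $x$ for $(x,0)$ and $x'$ for $(x,1)$ in $X\times\{0,1\}$. $\mathcal M(X)$ is the set of all metrics $d$ on $X\times\{0,1\}$ (metrics on the double of $X$) whose restriction to each of the two copies of $X$ equals $d_X$ and for which $\inf_{x,y\in X}d(x,y')>0$. Equivalence: $d_1\sim d_2$ if there exist $\alpha>0$, $\beta\ge 1$ with $-\alpha+\frac1\beta d_1(x,y')\le d_2(x,y')\le\alpha+\beta d_1(x,y')$ for all $x,y\in X$. $[d]$ is the class of $d$ and $M(X)=\mathcal M(X)/\sim$. Composition: for $\rho,d\in\mathcal M(X)$, $\rho d\in\mathcal M(X)$ is given by $\rho d(x,z')=\inf_{y\in X}[d(x,y')+\rho(y,z')]$. It is associative and respects $\sim$, so $M(X)$ is a semigroup with $[\rho][d]=[\rho d]$. Gromov--Hausdorff distance: given a metric $d$ on the disjoint union $X\sqcup Y$ with $d|_X=d_X$ and $d|_Y=d_Y$, put $d_H(X,Y)=\max(\sup_{x\in X}d(x,Y),\sup_{y\in Y}d(y,X))$; the Gromov--Hausdorff distance between $X$ and $Y$ is the infimum of $d_H(X,Y)$ over all such metrics $d$ (it may be infinite). *)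

theory Defs
  imports "HOL-Analysis.Analysis"
begin

section \<open>Metrics on the double of a metric space\<close>

text \<open>
  The metric space \<open>X\<close> is a type \<open>'a\<close> of class \<^class>\<open>metric_space\<close>. A point \<open>(x, False)\<close> of
  \<open>'a \<times> bool\<close> is \<open>x = (x, 0)\<close> and \<open>(x, True)\<close> is \<open>x' = (x, 1)\<close>.
\<close>

definition double_metrics :: "('a::metric_space \<times> bool \<Rightarrow> 'a \<times> bool \<Rightarrow> real) set" where
  "double_metrics = {d. Metric_space UNIV d \<and>
     (\<forall>x y. d (x, False) (y, False) = dist x y) \<and>
     (\<forall>x y. d (x, True) (y, True) = dist x y) \<and>
     (INF (x, y). d (x, False) (y, True)) > 0}"

text \<open>
  An element of \<^const>\<open>double_metrics\<close> is determined by its values \<open>c x y = d(x, y')\<close>; the following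
  function recovers \<open>d\<close> from \<open>c\<close>.
\<close>

fun glue :: "('a::metric_space \<Rightarrow> 'a \<Rightarrow> real) \<Rightarrow> 'a \<times> bool \<Rightarrow> 'a \<times> bool \<Rightarrow> real" where
  "glue c (x, False) (y, False) = dist x y"
| "glue c (x, True) (y, True) = dist x y"
| "glue c (x, False) (y, True) = c x y"
| "glue c (x, True) (y, False) = c y x"

lemma glue_in_double_metrics:
  fixes c :: "'a::metric_space \<Rightarrow> 'a \<Rightarrow> real"
  assumes e: "e > 0" "\<And>x y. e \<le> c x y"
    and l: "\<And>x y z. c x z \<le> dist x y + c y z"
    and r: "\<And>x y z. c x z \<le> c x y + dist y z"
    and t1: "\<And>x y z. dist x y \<le> c x z + c y z"
    and t2: "\<And>x y z. dist x y \<le> c z x + c z y"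
  shows "glue c \<in> double_metrics"
proof -
  have pos: "c x y > 0" for x y
    using e by (meson less_le_trans)
  have "Metric_space UNIV (glue c)"
  proof
    fix p q s :: "'a \<times> bool"
    obtain x i y j z k where [simp]: "p = (x, i)" "q = (y, j)" "s = (z, k)"
      by (metis surj_pair)
    show "0 \<le> glue c p q"
      using pos[of x y] pos[of y x] by (cases i; cases j) auto
    show "glue c p q = glue c q p"
      by (cases i; cases j) (auto simp: dist_commute)
    show "glue c p q = 0 \<longleftrightarrow> p = q"
      using pos[of x y] pos[of y x] by (cases i; cases j) auto
    show "glue c p s \<le> glue c p q + glue c q s"
      using l[of x z y] r[of x z y] t1[of x z y] t2[of x z y] l[of z x y] r[of z x y]
        dist_triangle[of x z y]
      by (cases i; cases j; cases k) (auto simp: dist_commute)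
  qed
  moreover have "e \<le> (INF (x, y). c x y)"
    by (rule cINF_greatest) (use e in auto)
  ultimately show ?thesis
    using e(1) by (simp add: double_metrics_def)
qed

typedef (overloaded) 'a double_metric =
  "double_metrics :: ('a::metric_space \<times> bool \<Rightarrow> 'a \<times> bool \<Rightarrow> real) set"
proof
  show "glue (\<lambda>x y. dist x y + 1) \<in> (double_metrics :: ('a \<times> bool \<Rightarrow> 'a \<times> bool \<Rightarrow> real) set)"
  proof (rule glue_in_double_metrics[of 1])
    fix x y z :: 'a
    show "dist x z + 1 \<le> dist x y + (dist y z + 1)" "dist x z + 1 \<le> dist x y + 1 + dist y z"
      using dist_triangle[of x z y] by auto
    show "dist x y \<le> dist x z + 1 + (dist y z + 1)"
      using dist_triangle2[of x y z] by auto
    show "dist x y \<le> dist z x + 1 + (dist z y + 1)"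
      using dist_triangle3[of x y z] by auto
  qed auto
qed

setup_lifting type_definition_double_metric

lift_definition cross :: "'a::metric_space double_metric \<Rightarrow> 'a \<Rightarrow> 'a \<Rightarrow> real"
  is "\<lambda>d x y. d (x, False) (y, True)" .

lemma Metric_space_Rep_double_metric: "Metric_space UNIV (Rep_double_metric d)"
  using Rep_double_metric[of d] by (simp add: double_metrics_def)

lemma Rep_double_metric_simps:
  "Rep_double_metric d (x, False) (y, False) = dist x y"
  "Rep_double_metric d (x, True) (y, True) = dist x y"
  "Rep_double_metric d (x, False) (y, True) = cross d x y"
  "Rep_double_metric d (x, True) (y, False) = cross d y x"
  using Rep_double_metric[of d] Metric_space.commute[OF Metric_space_Rep_double_metric]
  by (auto simp: double_metrics_def cross.rep_eq)

lemma Rep_double_metric_eq_glue: "Rep_double_metric d = glue (cross d)"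
proof (intro ext)
  fix p q :: "'a \<times> bool"
  show "Rep_double_metric d p q = glue (cross d) p q"
    by (cases p; cases q; cases "snd p"; cases "snd q") (auto simp: Rep_double_metric_simps)
qed

lemma double_metric_eqI: "cross d = cross d' \<Longrightarrow> d = d'"
  by (metis Rep_double_metric_eq_glue Rep_double_metric_inject)

lemma cross_nonneg: "0 \<le> cross d x y"
  using Metric_space.nonneg[OF Metric_space_Rep_double_metric] by (simp add: cross.rep_eq)

lemma cross_triangle:
  "cross d x z \<le> dist x y + cross d y z"
  "cross d x z \<le> cross d x y + dist y z"
  "dist x y \<le> cross d x z + cross d y z"
  "dist x y \<le> cross d z x + cross d z y"
  using Metric_space.triangle[OF Metric_space_Rep_double_metric, of "(x, False)" "(y, False)" "(z, True)" d]
    Metric_space.triangle[OF Metric_space_Rep_double_metric, of "(x, False)" "(y, True)" "(z, True)" d]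
    Metric_space.triangle[OF Metric_space_Rep_double_metric, of "(x, False)" "(z, True)" "(y, False)" d]
    Metric_space.triangle[OF Metric_space_Rep_double_metric, of "(x, True)" "(z, False)" "(y, True)" d]
  by (simp_all add: Rep_double_metric_simps)

lemma cross_bound: obtains e where "e > 0" "\<And>x y. e \<le> cross d x y"
proof
  show "(INF (x, y). cross d x y) > 0"
    using Rep_double_metric[of d] by (simp add: double_metrics_def cross.rep_eq)
  fix x y
  have "bdd_below (range (\<lambda>(x, y). cross d x y))"
    by (rule bdd_belowI[of _ 0]) (auto simp: cross_nonneg)
  then show "(INF (x, y). cross d x y) \<le> cross d x y"
    using cINF_lower[of "\<lambda>(x, y). cross d x y" UNIV "(x, y)"] by simp
qed


section \<open>Composition\<close>

definition comp_cross ::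
  "'a::metric_space double_metric \<Rightarrow> 'a double_metric \<Rightarrow> 'a \<Rightarrow> 'a \<Rightarrow> real" where
  "comp_cross \<rho> d x z = (INF y. cross d x y + cross \<rho> y z)"

lemma comp_cross_le: "comp_cross \<rho> d x z \<le> cross d x y + cross \<rho> y z"
  unfolding comp_cross_def
  by (rule cINF_lower) (auto intro!: bdd_belowI[of _ 0] add_nonneg_nonneg cross_nonneg)

lemma comp_cross_greatest: "(\<And>y. a \<le> cross d x y + cross \<rho> y z) \<Longrightarrow> a \<le> comp_cross \<rho> d x z"
  unfolding comp_cross_def by (rule cINF_greatest) auto

lemma glue_comp_cross: "glue (comp_cross \<rho> d) \<in> double_metrics"
proof -
  obtain e where e: "e > 0" "\<And>x y. e \<le> cross d x y"
    using cross_bound[of d] by blast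
  show ?thesis
  proof (rule glue_in_double_metrics[OF e(1)])
    fix x y z
    show "e \<le> comp_cross \<rho> d x y"
      by (intro comp_cross_greatest add_increasing2 cross_nonneg e(2))
    have "comp_cross \<rho> d x z - dist x y \<le> comp_cross \<rho> d y z"
    proof (rule comp_cross_greatest)
      fix w
      show "comp_cross \<rho> d x z - dist x y \<le> cross d y w + cross \<rho> w z"
        using comp_cross_le[of \<rho> d x z w] cross_triangle(1)[of d x w y] by linarith
    qed
    then show "comp_cross \<rho> d x z \<le> dist x y + comp_cross \<rho> d y z" by simp
    have "comp_cross \<rho> d x z - dist y z \<le> comp_cross \<rho> d x y"
    proof (rule comp_cross_greatest)
      fix w
      show "comp_cross \<rho> d x z - dist y z \<le> cross d x w + cross \<rho> w y"
        using comp_cross_le[of \<rho> d x z w] cross_triangle(2)[of \<rho> w z y] by linarith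
    qed
    then show "comp_cross \<rho> d x z \<le> comp_cross \<rho> d x y + dist y z" by simp
    have "dist x y - comp_cross \<rho> d y z \<le> comp_cross \<rho> d x z"
    proof (rule comp_cross_greatest)
      fix w
      have "dist x y - (cross d x w + cross \<rho> w z) \<le> comp_cross \<rho> d y z"
      proof (rule comp_cross_greatest)
        fix v
        show "dist x y - (cross d x w + cross \<rho> w z) \<le> cross d y v + cross \<rho> v z"
          using cross_triangle(3)[of x y d v] cross_triangle(2)[of d x v w] cross_triangle(3)[of w v \<rho> z]
          by linarith
      qed
      then show "dist x y - comp_cross \<rho> d y z \<le> cross d x w + cross \<rho> w z" by simp
    qed
    then show "dist x y \<le> comp_cross \<rho> d x z + comp_cross \<rho> d y z" by simp
    have "dist x y - comp_cross \<rho> d z y \<le> comp_cross \<rho> d z x"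
    proof (rule comp_cross_greatest)
      fix w
      have "dist x y - (cross d z w + cross \<rho> w x) \<le> comp_cross \<rho> d z y"
      proof (rule comp_cross_greatest)
        fix v
        show "dist x y - (cross d z w + cross \<rho> w x) \<le> cross d z v + cross \<rho> v y"
          using cross_triangle(4)[of x y \<rho> w] cross_triangle(1)[of \<rho> w y v] cross_triangle(4)[of w v d z]
          by linarith
      qed
      then show "dist x y - comp_cross \<rho> d z y \<le> cross d z w + cross \<rho> w x" by simp
    qed
    then show "dist x y \<le> comp_cross \<rho> d z x + comp_cross \<rho> d z y" by simp
  qed
qed

lift_definition comp_metric ::
  "'a::metric_space double_metric \<Rightarrow> 'a double_metric \<Rightarrow> 'a double_metric"
  is "\<lambda>\<rho> d. glue (\<lambda>x z. INF y. d (x, False) (y, True) + \<rho> (y, False) (z, True))"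
  subgoal for \<rho> d
    using glue_comp_cross[of "Abs_double_metric \<rho>" "Abs_double_metric d"]
    by (simp add: comp_cross_def[abs_def] cross.rep_eq Abs_double_metric_inverse)
  done

lemma cross_comp_metric: "cross (comp_metric \<rho> d) = comp_cross \<rho> d"
  by (intro ext) (simp add: cross.rep_eq comp_metric.rep_eq comp_cross_def)

lemma comp_metric_assoc:
  "comp_metric (comp_metric \<rho> \<sigma>) d = comp_metric \<rho> (comp_metric \<sigma> d)"
proof (rule double_metric_eqI, intro ext antisym)
  fix x z
  show "cross (comp_metric (comp_metric \<rho> \<sigma>) d) x z \<le> cross (comp_metric \<rho> (comp_metric \<sigma> d)) x z"
    (is "?L \<le> _")
    unfolding cross_comp_metric
  proof (rule comp_cross_greatest)
    fix w
    have "comp_cross (comp_metric \<rho> \<sigma>) d x z - cross \<rho> w z \<le> comp_cross \<sigma> d x w"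
    proof (rule comp_cross_greatest)
      fix y
      show "comp_cross (comp_metric \<rho> \<sigma>) d x z - cross \<rho> w z \<le> cross d x y + cross \<sigma> y w"
        using comp_cross_le[of "comp_metric \<rho> \<sigma>" d x z y] comp_cross_le[of \<rho> \<sigma> y z w]
        by (simp add: cross_comp_metric)
    qed
    then show "comp_cross (comp_metric \<rho> \<sigma>) d x z \<le> cross (comp_metric \<sigma> d) x w + cross \<rho> w z"
      by (simp add: cross_comp_metric)
  qed
  show "cross (comp_metric \<rho> (comp_metric \<sigma> d)) x z \<le> cross (comp_metric (comp_metric \<rho> \<sigma>) d) x z"
    unfolding cross_comp_metric
  proof (rule comp_cross_greatest)
    fix y
    have "comp_cross \<rho> (comp_metric \<sigma> d) x z - cross d x y \<le> comp_cross \<rho> \<sigma> y z"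
    proof (rule comp_cross_greatest)
      fix w
      show "comp_cross \<rho> (comp_metric \<sigma> d) x z - cross d x y \<le> cross \<sigma> y w + cross \<rho> w z"
        using comp_cross_le[of \<rho> "comp_metric \<sigma> d" x z w] comp_cross_le[of \<sigma> d x w y]
        by (simp add: cross_comp_metric)
    qed
    then show "comp_cross \<rho> (comp_metric \<sigma> d) x z \<le> cross d x y + cross (comp_metric \<rho> \<sigma>) y z"
      by (simp add: cross_comp_metric)
  qed
qed


section \<open>The semigroup of equivalence classes\<close>

definition coarse_eq :: "'a::metric_space double_metric \<Rightarrow> 'a double_metric \<Rightarrow> bool" where
  "coarse_eq d1 d2 \<longleftrightarrow> (\<exists>\<alpha> \<beta>::real. \<alpha> > 0 \<and> \<beta> \<ge> 1 \<and>
     (\<forall>x y. - \<alpha> + 1 / \<beta> * cross d1 x y \<le> cross d2 x y \<and>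
            cross d2 x y \<le> \<alpha> + \<beta> * cross d1 x y))"

lemma coarse_eq_upper:
  assumes "coarse_eq d1 d2"
  obtains \<alpha> \<beta> :: real where "\<alpha> > 0" "\<beta> \<ge> 1"
    "\<And>x y. cross d2 x y \<le> \<alpha> + \<beta> * cross d1 x y"
    "\<And>x y. cross d1 x y \<le> \<alpha> + \<beta> * cross d2 x y"
proof -
  obtain \<alpha> \<beta> :: real where ab: "\<alpha> > 0" "\<beta> \<ge> 1"
    and h: "\<And>x y. - \<alpha> + 1 / \<beta> * cross d1 x y \<le> cross d2 x y"
      "\<And>x y. cross d2 x y \<le> \<alpha> + \<beta> * cross d1 x y"
    using assms unfolding coarse_eq_def by blast
  have m: "\<alpha> * 1 \<le> \<alpha> * \<beta>"
    using ab by (intro mult_left_mono) auto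
  show thesis
  proof
    show "\<alpha> * \<beta> > 0" "\<beta> \<ge> 1" using ab by auto
    show "cross d2 x y \<le> \<alpha> * \<beta> + \<beta> * cross d1 x y" for x y
      using h(2)[of x y] m by linarith
    show "cross d1 x y \<le> \<alpha> * \<beta> + \<beta> * cross d2 x y" for x y
      using h(1)[of x y] ab by (simp add: field_simps)
  qed
qed

lemma coarse_eqI:
  fixes \<alpha> \<beta> :: real
  assumes ab: "\<alpha> > 0" "\<beta> \<ge> 1"
    and h: "\<And>x y. cross d2 x y \<le> \<alpha> + \<beta> * cross d1 x y"
      "\<And>x y. cross d1 x y \<le> \<alpha> + \<beta> * cross d2 x y"
  shows "coarse_eq d1 d2"
proof -
  have "- \<alpha> + 1 / \<beta> * cross d1 x y \<le> cross d2 x y" for x y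
  proof -
    have "\<alpha> * 1 \<le> \<alpha> * \<beta>"
      using ab by (intro mult_left_mono) auto
    then have "cross d1 x y \<le> \<beta> * (\<alpha> + cross d2 x y)"
      using h(2)[of x y] by (simp add: algebra_simps)
    then have "cross d1 x y / \<beta> \<le> \<alpha> + cross d2 x y"
      using ab by (simp add: pos_divide_le_eq mult.commute)
    then show ?thesis by simp
  qed
  then show ?thesis
    using ab h(1) unfolding coarse_eq_def by blast
qed

lemma equivp_coarse_eq: "equivp (coarse_eq :: 'a::metric_space double_metric \<Rightarrow> 'a double_metric \<Rightarrow> bool)"
proof (rule equivpI)
  let ?R = "coarse_eq :: 'a double_metric \<Rightarrow> 'a double_metric \<Rightarrow> bool"
  show "reflp ?R"
    by (rule reflpI, rule coarse_eqI[of 1 1]) auto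
  show "symp ?R"
  proof (rule sympI)
    fix d1 d2 :: "'a double_metric"
    assume "coarse_eq d1 d2"
    then show "coarse_eq d2 d1"
      by (metis coarse_eq_upper coarse_eqI)
  qed
  show "transp ?R"
  proof (rule transpI)
    fix d1 d2 d3 :: "'a double_metric"
    assume d12: "coarse_eq d1 d2" and d23: "coarse_eq d2 d3"
    obtain \<alpha> \<beta> :: real where ab1: "\<alpha> > 0" "\<beta> \<ge> 1"
      and h1: "\<And>x y. cross d2 x y \<le> \<alpha> + \<beta> * cross d1 x y"
        "\<And>x y. cross d1 x y \<le> \<alpha> + \<beta> * cross d2 x y"
      using coarse_eq_upper[OF d12] by metis
    obtain \<gamma> \<delta> :: real where ab2: "\<gamma> > 0" "\<delta> \<ge> 1"
      and h2: "\<And>x y. cross d3 x y \<le> \<gamma> + \<delta> * cross d2 x y"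
        "\<And>x y. cross d2 x y \<le> \<gamma> + \<delta> * cross d3 x y"
      using coarse_eq_upper[OF d23] by metis
    note ab = ab1 ab2 and h = h1 h2
    have p: "0 < \<delta> * \<alpha>" "0 < \<beta> * \<gamma>" using ab by auto
    show "coarse_eq d1 d3"
    proof (rule coarse_eqI)
      show "\<alpha> + \<gamma> + \<delta> * \<alpha> + \<beta> * \<gamma> > 0" using p ab by linarith
      show "\<beta> * \<delta> \<ge> 1" using ab mult_mono[of 1 \<beta> 1 \<delta>] by simp
      fix x y
      have "\<delta> * cross d2 x y \<le> \<delta> * (\<alpha> + \<beta> * cross d1 x y)"
        using ab h by (intro mult_left_mono) auto
      also have "\<dots> = \<delta> * \<alpha> + \<beta> * \<delta> * cross d1 x y"
        by (simp add: algebra_simps)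
      finally show "cross d3 x y \<le> \<alpha> + \<gamma> + \<delta> * \<alpha> + \<beta> * \<gamma> + \<beta> * \<delta> * cross d1 x y"
        using h(3)[of x y] ab p by linarith
      have "\<beta> * cross d2 x y \<le> \<beta> * (\<gamma> + \<delta> * cross d3 x y)"
        using ab h by (intro mult_left_mono) auto
      also have "\<dots> = \<beta> * \<gamma> + \<beta> * \<delta> * cross d3 x y"
        by (simp add: algebra_simps)
      finally show "cross d1 x y \<le> \<alpha> + \<gamma> + \<delta> * \<alpha> + \<beta> * \<gamma> + \<beta> * \<delta> * cross d3 x y"
        using h(2)[of x y] ab p by linarith
    qed
  qed
qed

lemma comp_cross_mono:
  fixes \<alpha> \<beta> \<gamma> \<delta> :: real
  assumes ab: "\<alpha> > 0" "\<beta> \<ge> 1" "\<gamma> > 0" "\<delta> \<ge> 1"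
    and h: "\<And>x y. cross \<rho>' x y \<le> \<alpha> + \<beta> * cross \<rho> x y"
      "\<And>x y. cross d' x y \<le> \<gamma> + \<delta> * cross d x y"
  shows "comp_cross \<rho>' d' x z \<le> (\<alpha> + \<gamma>) + max \<beta> \<delta> * comp_cross \<rho> d x z"
proof -
  let ?m = "max \<beta> \<delta>"
  have m: "?m > 0" using ab by auto
  have "(comp_cross \<rho>' d' x z - (\<alpha> + \<gamma>)) / ?m \<le> comp_cross \<rho> d x z"
  proof (rule comp_cross_greatest)
    fix y
    have "\<beta> * cross \<rho> y z \<le> ?m * cross \<rho> y z" "\<delta> * cross d x y \<le> ?m * cross d x y"
      by (auto intro!: mult_right_mono cross_nonneg)
    then have "comp_cross \<rho>' d' x z - (\<alpha> + \<gamma>) \<le> ?m * (cross d x y + cross \<rho> y z)"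
      using comp_cross_le[of \<rho>' d' x z y] h(1)[of y z] h(2)[of x y]
      unfolding distrib_left by linarith
    then show "(comp_cross \<rho>' d' x z - (\<alpha> + \<gamma>)) / ?m \<le> cross d x y + cross \<rho> y z"
      using m by (simp add: pos_divide_le_eq mult.commute)
  qed
  then have "comp_cross \<rho>' d' x z - (\<alpha> + \<gamma>) \<le> ?m * comp_cross \<rho> d x z"
    using m by (simp add: pos_divide_le_eq mult.commute)
  then show ?thesis by linarith
qed

lemma coarse_eq_comp_metric:
  assumes "coarse_eq \<rho> \<rho>'" "coarse_eq d d'"
  shows "coarse_eq (comp_metric \<rho> d) (comp_metric \<rho>' d')"
proof -
  obtain \<alpha> \<beta> :: real where 1: "\<alpha> > 0" "\<beta> \<ge> 1"
    "\<And>x y. cross \<rho>' x y \<le> \<alpha> + \<beta> * cross \<rho> x y"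
    "\<And>x y. cross \<rho> x y \<le> \<alpha> + \<beta> * cross \<rho>' x y"
    using coarse_eq_upper[OF assms(1)] by metis
  obtain \<gamma> \<delta> :: real where 2: "\<gamma> > 0" "\<delta> \<ge> 1"
    "\<And>x y. cross d' x y \<le> \<gamma> + \<delta> * cross d x y"
    "\<And>x y. cross d x y \<le> \<gamma> + \<delta> * cross d' x y"
    using coarse_eq_upper[OF assms(2)] by metis
  show ?thesis
  proof (rule coarse_eqI)
    show "\<alpha> + \<gamma> > 0" "max \<beta> \<delta> \<ge> 1" using 1 2 by auto
    show "cross (comp_metric \<rho>' d') x y \<le> \<alpha> + \<gamma> + max \<beta> \<delta> * cross (comp_metric \<rho> d) x y" for x y
      unfolding cross_comp_metric by (rule comp_cross_mono[OF 1(1,2) 2(1,2) 1(3) 2(3)])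
    show "cross (comp_metric \<rho> d) x y \<le> \<alpha> + \<gamma> + max \<beta> \<delta> * cross (comp_metric \<rho>' d') x y" for x y
      unfolding cross_comp_metric by (rule comp_cross_mono[OF 1(1,2) 2(1,2) 1(4) 2(4)])
  qed
qed

quotient_type (overloaded) 'a metric_class = "'a::metric_space double_metric" / coarse_eq
  by (rule equivp_coarse_eq)

instantiation metric_class :: (metric_space) semigroup_mult
begin

lift_definition times_metric_class ::
  "'a metric_class \<Rightarrow> 'a metric_class \<Rightarrow> 'a metric_class" is comp_metric
  by (rule coarse_eq_comp_metric)

instance
proof
  fix a b c :: "'a metric_class"
  show "a * b * c = a * (b * c)"
  proof transfer
    fix a b c :: "'a double_metric"
    show "coarse_eq (comp_metric (comp_metric a b) c) (comp_metric a (comp_metric b c))"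
      unfolding comp_metric_assoc by (rule equivp_reflp[OF equivp_coarse_eq])
  qed
qed

end

definition semigroup_iso :: "('s::semigroup_mult \<Rightarrow> 't::semigroup_mult) \<Rightarrow> bool" where
  "semigroup_iso \<phi> \<longleftrightarrow> bij \<phi> \<and> (\<forall>s t. \<phi> (s * t) = \<phi> s * \<phi> t)"


section \<open>Gromov--Hausdorff distance\<close>

definition disjoint_union_metrics ::
  "('a::metric_space + 'b::metric_space \<Rightarrow> 'a + 'b \<Rightarrow> real) set" where
  "disjoint_union_metrics = {d. Metric_space UNIV d \<and>
     (\<forall>x x'. d (Inl x) (Inl x') = dist x x') \<and>
     (\<forall>y y'. d (Inr y) (Inr y') = dist y y')}"

definition Hausdorff_dist_sum :: "('a + 'b \<Rightarrow> 'a + 'b \<Rightarrow> real) \<Rightarrow> ennreal" where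
  "Hausdorff_dist_sum d =
     max (SUP x. INF y. ennreal (d (Inl x) (Inr y))) (SUP y. INF x. ennreal (d (Inr y) (Inl x)))"

definition Gromov_Hausdorff_dist ::
  "'a::metric_space itself \<Rightarrow> 'b::metric_space itself \<Rightarrow> ennreal" where
  "Gromov_Hausdorff_dist _ _ =
     (INF d \<in> (disjoint_union_metrics :: ('a + 'b \<Rightarrow> 'a + 'b \<Rightarrow> real) set). Hausdorff_dist_sum d)"

end

(* A metric on the disjoint union with finite Hausdorff distance gives a distance function m between
   points of X and points of Y for which every point of one space lies within D of some point of the
   other. A metric d on the double of Y is pulled back along m by
     (x, y') \<mapsto> inf over u, v of m(x, u) + d(u, v') + m(y, v),
   the cheapest path that crosses in Y; it differs from d(f x, (f y)') by at most 2 D, whenever f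
   moves points by at most D. Hence pulling back respects equivalence and, up to bounded error,
   composition, and pulling back along m and then along its transpose is bounded error as well. *)
theory Submission
  imports Defs
begin

lemma coarse_eq_if_bounded_diff:
  assumes "\<And>x y. \<bar>cross d x y - cross d' x y\<bar> \<le> C"
  shows "coarse_eq d d'"
proof (rule coarse_eqI)
  show "\<bar>C\<bar> + 1 > 0" by simp
  show "cross d' x y \<le> \<bar>C\<bar> + 1 + 1 * cross d x y"
    "cross d x y \<le> \<bar>C\<bar> + 1 + 1 * cross d' x y" for x y
    using assms[of x y] by linarith+
qed simp

section \<open>Pulling back double metrics along a distance function\<close>

definition pullback_cross ::
  "('a \<Rightarrow> 'b \<Rightarrow> real) \<Rightarrow> 'b::metric_space double_metric \<Rightarrow> 'a \<Rightarrow> 'a \<Rightarrow> real" where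
  "pullback_cross m d x y = (INF (u, v). m x u + cross d u v + m y v)"

text \<open>For arbitrary \<open>m\<close> the glued function need not be a double metric, so the
  value of \<open>Abs_double_metric\<close> is meaningful only under \<open>close_coupling\<close>,
  by \<open>glue_pullback_cross\<close>.\<close>

definition pullback_metric ::
  "('a \<Rightarrow> 'b \<Rightarrow> real) \<Rightarrow> 'b::metric_space double_metric \<Rightarrow> 'a::metric_space double_metric" where
  "pullback_metric m d = Abs_double_metric (glue (pullback_cross m d))"

text \<open>Equivalence is respected only under assumptions on \<open>m\<close>, which rules out
  lifting to the quotient; hence the chosen representative.\<close>

definition pullback_class ::
  "('a \<Rightarrow> 'b \<Rightarrow> real) \<Rightarrow> 'b::metric_space metric_class \<Rightarrow> 'a::metric_space metric_class" where
  "pullback_class m c = abs_metric_class (pullback_metric m (rep_metric_class c))"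

text \<open>The first four conditions are the mixed triangle inequalities of a pseudometric on the
  disjoint union, with \<open>m\<close> its values between the two spaces; the last two keep each
  space within \<open>D\<close> of the other.\<close>

locale close_coupling =
  fixes m :: "'a::metric_space \<Rightarrow> 'b::metric_space \<Rightarrow> real" and D :: real
  assumes left_le: "m x u \<le> dist x y + m y u"
    and right_le: "m x u \<le> m x v + dist v u"
    and dist_left_le: "dist x y \<le> m x u + m y u"
    and dist_right_le: "dist u v \<le> m x u + m x v"
    and ex_right: "\<exists>u. m x u \<le> D"
    and ex_left: "\<exists>x. m x u \<le> D"
begin

lemma flip: "close_coupling (\<lambda>u x. m x u) D"
proof
  fix x y u v
  show "m x u \<le> dist u v + m x v" using right_le[of x u v] by (simp add: dist_commute)
  show "m x u \<le> m y u + dist y x" using left_le[of x u y] by (simp add: dist_commute)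
qed (auto intro: dist_left_le dist_right_le ex_left ex_right)

lemma nonneg: "0 \<le> m x u"
  using dist_left_le[of x x u] by simp

definition to_right where "to_right x = (SOME u. m x u \<le> D)"

definition to_left where "to_left u = (SOME x. m x u \<le> D)"

lemma to_right: "m x (to_right x) \<le> D"
  unfolding to_right_def by (rule someI_ex[OF ex_right])

lemma to_left: "m (to_left u) u \<le> D"
  unfolding to_left_def by (rule someI_ex[OF ex_left])

lemma pullback_cross_le: "pullback_cross m d x y \<le> m x u + cross d u v + m y v"
proof -
  have "bdd_below (range (\<lambda>(u, v). m x u + cross d u v + m y v))"
    by (rule bdd_belowI[of _ 0]) (auto intro!: add_nonneg_nonneg nonneg cross_nonneg)
  then show ?thesis
    unfolding pullback_cross_def
    using cINF_lower[of "\<lambda>(u, v). m x u + cross d u v + m y v" UNIV "(u, v)"] by simp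
qed

lemma pullback_cross_greatest:
  "(\<And>u v. a \<le> m x u + cross d u v + m y v) \<Longrightarrow> a \<le> pullback_cross m d x y"
  unfolding pullback_cross_def by (rule cINF_greatest) auto

lemma glue_pullback_cross: "glue (pullback_cross m d) \<in> double_metrics"
proof -
  obtain e where e: "e > 0" "\<And>x y. e \<le> cross d x y"
    using cross_bound[of d] by blast
  show ?thesis
  proof (rule glue_in_double_metrics[OF e(1)])
    fix x y z
    show "e \<le> pullback_cross m d x y"
      by (intro pullback_cross_greatest add_increasing2 add_increasing nonneg e(2))
    have "pullback_cross m d x z - dist x y \<le> pullback_cross m d y z"
    proof (rule pullback_cross_greatest)
      fix u v
      show "pullback_cross m d x z - dist x y \<le> m y u + cross d u v + m z v"
        using pullback_cross_le[of d x z u v] left_le[of x u y] by linarith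
    qed
    then show "pullback_cross m d x z \<le> dist x y + pullback_cross m d y z" by simp
    have "pullback_cross m d x z - dist y z \<le> pullback_cross m d x y"
    proof (rule pullback_cross_greatest)
      fix u v
      show "pullback_cross m d x z - dist y z \<le> m x u + cross d u v + m y v"
        using pullback_cross_le[of d x z u v] left_le[of z v y] dist_commute[of y z] by linarith
    qed
    then show "pullback_cross m d x z \<le> pullback_cross m d x y + dist y z" by simp
    have "dist x y - pullback_cross m d y z \<le> pullback_cross m d x z"
    proof (rule pullback_cross_greatest)
      fix u v
      \<comment> \<open>The two infima are bounded one after the other: the path from
        \<open>x\<close> is fixed first, then the one from \<open>y\<close>.\<close>
      have "dist x y - (m x u + cross d u v + m z v) \<le> pullback_cross m d y z"
      proof (rule pullback_cross_greatest)
        fix u' v'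
        show "dist x y - (m x u + cross d u v + m z v) \<le> m y u' + cross d u' v' + m z v'"
          \<comment> \<open>Follows the chain \<open>x\<close>, \<open>u\<close>, \<open>v\<close>,
            \<open>z\<close>, \<open>v'\<close>, \<open>u'\<close>, \<open>y\<close>, with
            \<open>v\<close> and \<open>v'\<close> in the second copy.\<close>
          using dist_left_le[of x y u] right_le[of y u u'] dist_commute[of u u']
            cross_triangle(3)[of u u' d v] cross_triangle(2)[of d u' v v']
            dist_right_le[of v v' z] dist_commute[of v v']
          by linarith
      qed
      then show "dist x y - pullback_cross m d y z \<le> m x u + cross d u v + m z v" by simp
    qed
    then show "dist x y \<le> pullback_cross m d x z + pullback_cross m d y z" by simp
    have "dist x y - pullback_cross m d z y \<le> pullback_cross m d z x"
    proof (rule pullback_cross_greatest)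
      fix u v
      have "dist x y - (m z u + cross d u v + m x v) \<le> pullback_cross m d z y"
      proof (rule pullback_cross_greatest)
        fix u' v'
        show "dist x y - (m z u + cross d u v + m x v) \<le> m z u' + cross d u' v' + m y v'"
          using dist_left_le[of x y v] right_le[of y v v'] dist_commute[of v v']
            cross_triangle(4)[of v v' d u] cross_triangle(1)[of d u v' u']
            dist_right_le[of u u' z] dist_commute[of u u']
          by linarith
      qed
      then show "dist x y - pullback_cross m d z y \<le> m z u + cross d u v + m x v" by simp
    qed
    then show "dist x y \<le> pullback_cross m d z x + pullback_cross m d z y" by simp
  qed
qed

lemma cross_pullback_metric: "cross (pullback_metric m d) = pullback_cross m d"
  by (intro ext)
    (simp add: pullback_metric_def cross.rep_eq Abs_double_metric_inverse glue_pullback_cross)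

text \<open>The path through \<open>u\<close> and \<open>v\<close> gives the upper bound. For the
  lower one, any other \<open>u'\<close> satisfies \<open>dist u u' \<le> D + m x u'\<close>, and
  likewise for \<open>v'\<close>. As \<open>u\<close> and \<open>v\<close> are arbitrary near
  points, both \<open>to_right\<close> and \<open>to_left\<close> can be used.\<close>

lemma cross_pullback_metric_bounds:
  assumes "m x u \<le> D" "m y v \<le> D"
  shows "\<bar>cross (pullback_metric m d) x y - cross d u v\<bar> \<le> 2 * D"
proof -
  have "cross d u v - 2 * D \<le> pullback_cross m d x y"
  proof (rule pullback_cross_greatest)
    fix u' v'
    show "cross d u v - 2 * D \<le> m x u' + cross d u' v' + m y v'"
      using assms cross_triangle(1)[of d u v u'] cross_triangle(2)[of d u' v v']
        dist_right_le[of u u' x] dist_right_le[of v' v y] by linarith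
  qed
  then show ?thesis
    using assms pullback_cross_le[of d x y u v] unfolding cross_pullback_metric by linarith
qed

section \<open>Compatibility with equivalence, composition and transposition\<close>

lemma coarse_eq_pullback_metric:
  assumes "coarse_eq d d'"
  shows "coarse_eq (pullback_metric m d) (pullback_metric m d')"
proof -
  obtain \<alpha> \<beta> :: real where ab: "\<alpha> > 0" "\<beta> \<ge> 1"
    and h: "\<And>x y. cross d' x y \<le> \<alpha> + \<beta> * cross d x y"
      "\<And>x y. cross d x y \<le> \<alpha> + \<beta> * cross d' x y"
    using coarse_eq_upper[OF assms] by metis
  have D: "D \<ge> 0" using order_trans[OF nonneg to_right] .
  \<comment> \<open>Passing to near points costs \<open>2 * D\<close> for \<open>d2\<close>, and
    \<open>2 * D\<close> scaled by \<beta> for \<open>d1\<close>. Keeping \<open>d1\<close> and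
    \<open>d2\<close> general serves both directions.\<close>
  have *: "cross (pullback_metric m d2) x y
      \<le> (\<alpha> + 2 * D + 2 * D * \<beta>) + \<beta> * cross (pullback_metric m d1) x y"
    if "\<And>x y. cross d2 x y \<le> \<alpha> + \<beta> * cross d1 x y" for d1 d2 x y
  proof -
    let ?u = "to_right x" and ?v = "to_right y"
    note b = cross_pullback_metric_bounds[OF to_right to_right, of _ x y]
    have "\<beta> * cross d1 ?u ?v \<le> \<beta> * (cross (pullback_metric m d1) x y + 2 * D)"
      using b[of d1] ab by (intro mult_left_mono) auto
    then show ?thesis
      using that[of ?u ?v] b[of d2] by (simp add: algebra_simps)
  qed
  show ?thesis
  proof (rule coarse_eqI)
    show "\<alpha> + 2 * D + 2 * D * \<beta> > 0"
      using ab D by (intro add_pos_nonneg) auto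
  qed (use ab * h in auto)
qed

text \<open>Intermediate points are carried across by \<open>to_right\<close> and
  \<open>to_left\<close>. Each of the two factors contributes an error \<open>2 * D\<close>, and so
  does the pullback of the composite, which gives \<open>6 * D\<close>.\<close>

lemma coarse_eq_pullback_comp:
  "coarse_eq (pullback_metric m (comp_metric \<rho> d))
     (comp_metric (pullback_metric m \<rho>) (pullback_metric m d))"
proof (rule coarse_eq_if_bounded_diff)
  fix x z
  let ?u = "to_right x" and ?v = "to_right z"
  let ?P = "comp_cross (pullback_metric m \<rho>) (pullback_metric m d) x z"
  note b = cross_pullback_metric_bounds
  have "comp_cross \<rho> d ?u ?v - 4 * D \<le> ?P"
  proof (rule comp_cross_greatest)
    fix y
    show "comp_cross \<rho> d ?u ?v - 4 * D
        \<le> cross (pullback_metric m d) x y + cross (pullback_metric m \<rho>) y z"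
      using comp_cross_le[of \<rho> d ?u ?v "to_right y"]
        b[OF to_right[of x] to_right[of y], of d] b[OF to_right[of y] to_right[of z], of \<rho>]
      by linarith
  qed
  \<comment> \<open>Here the intermediate point \<open>w\<close> lies in the other space, so it must
    have a near point in this one: this uses \<open>ex_left\<close>.\<close>
  moreover have "?P - 4 * D \<le> comp_cross \<rho> d ?u ?v"
  proof (rule comp_cross_greatest)
    fix w
    show "?P - 4 * D \<le> cross d ?u w + cross \<rho> w ?v"
      using comp_cross_le[of "pullback_metric m \<rho>" "pullback_metric m d" x z "to_left w"]
        b[OF to_right[of x] to_left[of w], of d] b[OF to_left[of w] to_right[of z], of \<rho>]
      by linarith
  qed
  ultimately show "\<bar>cross (pullback_metric m (comp_metric \<rho> d)) x z
      - cross (comp_metric (pullback_metric m \<rho>) (pullback_metric m d)) x z\<bar> \<le> 6 * D"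
    using b[OF to_right[of x] to_right[of z], of "comp_metric \<rho> d"]
    unfolding cross_comp_metric by linarith
qed

text \<open>The relation \<open>m x u \<le> D\<close> is the same for \<open>m\<close> and its
  transpose, so both pullbacks are compared at the points \<open>to_left u\<close> and
  \<open>to_left v\<close>, at a cost of \<open>2 * D\<close> each.\<close>

lemma coarse_eq_pullback_flip: "coarse_eq (pullback_metric (\<lambda>u x. m x u) (pullback_metric m d)) d"
proof (rule coarse_eq_if_bounded_diff)
  interpret flip: close_coupling "\<lambda>u x. m x u" D by (rule flip)
  fix u v
  show "\<bar>cross (pullback_metric (\<lambda>u x. m x u) (pullback_metric m d)) u v - cross d u v\<bar> \<le> 4 * D"
    using flip.cross_pullback_metric_bounds[OF to_left[of u] to_left[of v], of "pullback_metric m d"]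
      cross_pullback_metric_bounds[OF to_left[of u] to_left[of v], of d]
    by linarith
qed

section \<open>Passage to equivalence classes\<close>

lemma pullback_class_abs:
  "pullback_class m (abs_metric_class d) = abs_metric_class (pullback_metric m d)"
  unfolding pullback_class_def metric_class.abs_eq_iff
  by (rule coarse_eq_pullback_metric)
    (rule Quotient3_rep_abs[OF Quotient3_metric_class equivp_reflp[OF equivp_coarse_eq]])

lemma pullback_class_mult:
  "pullback_class m (s * t) = pullback_class m s * pullback_class m t"
proof (induct s; induct t)
  fix \<rho> d
  show "pullback_class m (abs_metric_class \<rho> * abs_metric_class d)
      = pullback_class m (abs_metric_class \<rho>) * pullback_class m (abs_metric_class d)"
    by (simp add: pullback_class_abs times_metric_class.abs_eq metric_class.abs_eq_iff
        coarse_eq_pullback_comp)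
qed

lemma pullback_class_flip: "pullback_class (\<lambda>u x. m x u) (pullback_class m c) = c"
proof (induct c)
  fix d
  interpret flip: close_coupling "\<lambda>u x. m x u" D by (rule flip)
  show "pullback_class (\<lambda>u x. m x u) (pullback_class m (abs_metric_class d)) = abs_metric_class d"
    by (simp add: pullback_class_abs flip.pullback_class_abs metric_class.abs_eq_iff
        coarse_eq_pullback_flip)
qed

lemma semigroup_iso_pullback_class: "semigroup_iso (pullback_class m)"
proof -
  interpret flip: close_coupling "\<lambda>u x. m x u" D by (rule flip)
  \<comment> \<open>Transposing twice returns \<open>m\<close>, so
    \<open>pullback_class_flip\<close> and its transposed instance give both inverse laws.\<close>
  have "bij (pullback_class m)"
    by (rule bij_betw_byWitness[where f' = "pullback_class (\<lambda>u x. m x u)"])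
      (auto simp: pullback_class_flip flip.pullback_class_flip)
  then show ?thesis
    by (simp add: semigroup_iso_def pullback_class_mult)
qed

end

section \<open>A coupling from finite Gromov-Hausdorff distance\<close>

lemma close_coupling_if_Gromov_Hausdorff_dist_finite:
  assumes "Gromov_Hausdorff_dist TYPE('a::metric_space) TYPE('b::metric_space) < \<infinity>"
  obtains m :: "'a::metric_space \<Rightarrow> 'b::metric_space \<Rightarrow> real" and D where "close_coupling m D"
proof -
  obtain d :: "'a + 'b \<Rightarrow> 'a + 'b \<Rightarrow> real" where d: "d \<in> disjoint_union_metrics"
    and fin: "Hausdorff_dist_sum d < \<infinity>"
    using assms unfolding Gromov_Hausdorff_dist_def INF_less_iff by blast
  have M: "Metric_space UNIV d"
    and l: "d (Inl x) (Inl x') = dist x x'" and r: "d (Inr y) (Inr y') = dist y y'" for x x' y y'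
    using d by (auto simp: disjoint_union_metrics_def)
  note tri = Metric_space.triangle[OF M UNIV_I UNIV_I UNIV_I]
    and comm = Metric_space.commute[OF M]
  obtain D where D: "D \<ge> 0" "Hausdorff_dist_sum d = ennreal D"
    using fin by (cases "Hausdorff_dist_sum d") auto
  \<comment> \<open>The infimum over near points need not be attained; the slack 1 yields an actual
    point.\<close>
  have lt: "ennreal D < ennreal (D + 1)"
    using D(1) by (simp add: ennreal_less_iff)
  have less: "a < D + 1" if "ennreal a < ennreal (D + 1)" for a
    using that D(1) by (metis add_nonneg_nonneg ennreal_leI not_le zero_le_one)
  have "close_coupling (\<lambda>x y. d (Inl x) (Inr y)) (D + 1)"
  proof
    fix x :: 'a
    have "(INF y. ennreal (d (Inl x) (Inr y))) \<le> Hausdorff_dist_sum d"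
      unfolding Hausdorff_dist_sum_def by (intro max.coboundedI1 SUP_upper) simp
    also note D(2)
    also note lt
    finally show "\<exists>y. d (Inl x) (Inr y) \<le> D + 1"
      unfolding INF_less_iff using less less_imp_le by blast
  next
    fix y :: 'b
    have "(INF x. ennreal (d (Inr y) (Inl x))) \<le> Hausdorff_dist_sum d"
      unfolding Hausdorff_dist_sum_def by (intro max.coboundedI2 SUP_upper) simp
    also note D(2)
    also note lt
    finally show "\<exists>x. d (Inl x) (Inr y) \<le> D + 1"
      unfolding INF_less_iff comm[of "Inr y"] using less less_imp_le by blast
  next
    fix x y :: 'a and u v :: 'b
    show "d (Inl x) (Inr u) \<le> dist x y + d (Inl y) (Inr u)"
      using tri[of "Inl x" "Inr u" "Inl y"] by (simp add: l)
    show "d (Inl x) (Inr u) \<le> d (Inl x) (Inr v) + dist v u"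
      using tri[of "Inl x" "Inr u" "Inr v"] by (simp add: r)
    show "dist x y \<le> d (Inl x) (Inr u) + d (Inl y) (Inr u)"
      using tri[of "Inl x" "Inl y" "Inr u"] comm[of "Inr u" "Inl y"] by (simp add: l)
    show "dist u v \<le> d (Inl x) (Inr u) + d (Inl x) (Inr v)"
      using tri[of "Inr u" "Inr v" "Inl x"] comm[of "Inr u" "Inl x"] by (simp add: r)
  qed
  then show thesis by (rule that)
qed

theorem proposition8p2:
  assumes "Gromov_Hausdorff_dist TYPE('a::metric_space) TYPE('b::metric_space) < \<infinity>"
  shows "\<exists>\<phi> :: 'a metric_class \<Rightarrow> 'b metric_class. semigroup_iso \<phi>"
proof -
  obtain m :: "'a \<Rightarrow> 'b \<Rightarrow> real" and D where "close_coupling m D"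
    using close_coupling_if_Gromov_Hausdorff_dist_finite[OF assms] .
  \<comment> \<open>Pulling back along \<open>m\<close> goes from classes over \<open>'b\<close> to
    classes over \<open>'a\<close>; the transpose gives the required direction.\<close>
  then have "semigroup_iso (pullback_class (\<lambda>u x. m x u))"
    by (rule close_coupling.flip[THEN close_coupling.semigroup_iso_pullback_class])
  then show ?thesis by blast
qed

end
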